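(* Let $n\in\mathbb{N}$ and $N=2^n$, let $v\in PL(n)$ be arbitrary and $\mathbf{v}=\mathcal{J}_nv\in\mathbb{R}^N$. Then the density $\Pi_{\mathbf{V}_n}$ of the probability measure $\nu_n\circ\mathcal{J}_n^{-1}$ on $\mathbb{R}^N$ satisfies $$\Pi_{\mathbf{V}_n}(\mathbf{v})\propto\exp\Big(-\frac12\Big(\epsilon\|Dv\|_{L^2}^2+\frac1{4\epsilon}\|v-\mathbf{1}\|_{L^2}^2\Big)\Big),$$ with $\mathbf{1}(x)=1$ for all $x\in\mathbb{T}$.
   Context: $\mathbb{T}$ is the unit circle, identified with $[0,1]$ with $1$ identified with $0$; $\epsilon>0$ is fixed; $D$ is the derivative. For $n\in\mathbb{N}$ let $N=2^n$, $K_j^N=[(j-1)/N,j/N)$, $j=1,\dots,N$, and $PL(n)=\{f\in C(\mathbb{T}):f\text{ is linear on each }K_j^N\}\subset H^1(\mathbb{T})$. Let $\{g_j\}_{j\ge1}$ be an orthonormal basis of $H^1(\mathbb{T})$ with respect to the inner product $\frac1{4\epsilon}\langle f,g\rangle_{L^2}+\epsilon\langle Df,Dg\rangle_{L^2}$ such that for each $n$ the set $\{g_j\}_{j=1}^N$ spans $PL(n)$. Define $V_n=\sum_{j=1}^N\mathbf{V}_j^Ng_j+\mathbf{1}$, where $\mathbf{V}_j^N$ are independent real random variables with standard normal distribution, and let $\nu_n$ be the distribution of $V_n$ (supported on $PL(n)$). The map $\mathcal{J}_n:PL(n)\to\mathbb{R}^N$ is $\mathcal{J}_n\big(\sum_{j=1}^N\mathbf{x}_jg_j\big)=\mathbf{x}$.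 The notation $\phi\propto\psi$ means $\phi\equiv c\,\psi$ with some constant $c$ (here independent of $\mathbf{v}$). *)

theory Defs
  imports "HOL-Probability.Probability"
begin

text \<open>
  A function on the unit circle is a function on the real line of period 1. The half-open interval
  is a fundamental domain, and integrals over the circle are integrals over it.
\<close>

definition periodic1 :: "(real \<Rightarrow> real) \<Rightarrow> bool" where
  "periodic1 f \<longleftrightarrow> (\<forall>x. f (x + 1) = f x)"

definition circle_measure :: "real measure" where
  "circle_measure = restrict_space lborel {0..<1}"

definition L2_circle :: "(real \<Rightarrow> real) set" where
  "L2_circle = {f. f \<in> borel_measurable circle_measure \<and> integrable circle_measure (\<lambda>x. (f x)\<^sup>2)}"

definition L2_inner :: "(real \<Rightarrow> real) \<Rightarrow> (real \<Rightarrow> real) \<Rightarrow> real" where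
  "L2_inner f h = (LINT x|circle_measure. f x * h x)"

definition L2_norm :: "(real \<Rightarrow> real) \<Rightarrow> real" where
  "L2_norm f = sqrt (L2_inner f f)"

definition test_fun :: "(real \<Rightarrow> real) \<Rightarrow> bool" where
  "test_fun \<phi> \<longleftrightarrow> periodic1 \<phi> \<and> (\<forall>k. (deriv ^^ k) \<phi> differentiable_on UNIV)"

definition weak_deriv :: "(real \<Rightarrow> real) \<Rightarrow> (real \<Rightarrow> real) \<Rightarrow> bool" where
  "weak_deriv f h \<longleftrightarrow> h \<in> L2_circle \<and>
     (\<forall>\<phi>. test_fun \<phi> \<longrightarrow> L2_inner f (deriv \<phi>) = - L2_inner h \<phi>)"

text \<open>
  The space of continuous functions and its subspace of Sobolev functions: every Sobolev class on
  the circle has exactly one continuous representative, which stands for the class.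
  The weak derivative is determined only almost everywhere; it is used only under integrals,
  which do not depend on the choice.
\<close>

definition C_circle :: "(real \<Rightarrow> real) set" where
  "C_circle = {f. periodic1 f \<and> continuous_on UNIV f}"

definition H1_circle :: "(real \<Rightarrow> real) set" where
  "H1_circle = {f \<in> C_circle. \<exists>h. weak_deriv f h}"

definition wderiv :: "(real \<Rightarrow> real) \<Rightarrow> real \<Rightarrow> real" where
  "wderiv f = (SOME h. weak_deriv f h)"

definition H1_inner :: "real \<Rightarrow> (real \<Rightarrow> real) \<Rightarrow> (real \<Rightarrow> real) \<Rightarrow> real" where
  "H1_inner \<epsilon> f h = 1 / (4 * \<epsilon>) * L2_inner f h + \<epsilon> * L2_inner (wderiv f) (wderiv h)"

definition H1_dist :: "real \<Rightarrow> (real \<Rightarrow> real) \<Rightarrow> (real \<Rightarrow> real) \<Rightarrow> real" where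
  "H1_dist \<epsilon> f h = sqrt (H1_inner \<epsilon> (\<lambda>x. f x - h x) (\<lambda>x. f x - h x))"

definition lin_comb :: "(nat \<Rightarrow> real \<Rightarrow> real) \<Rightarrow> nat \<Rightarrow> (nat \<Rightarrow> real) \<Rightarrow> real \<Rightarrow> real" where
  "lin_comb g N a = (\<lambda>x. \<Sum>j=1..N. a j * g j x)"

text \<open>The basis is indexed from 1; the value of the family at 0 is irrelevant.\<close>

definition H1_orthonormal_basis :: "real \<Rightarrow> (nat \<Rightarrow> real \<Rightarrow> real) \<Rightarrow> bool" where
  "H1_orthonormal_basis \<epsilon> g \<longleftrightarrow>
     (\<forall>j\<ge>1. g j \<in> H1_circle) \<and>
     (\<forall>i\<ge>1. \<forall>j\<ge>1. H1_inner \<epsilon> (g i) (g j) = (if i = j then 1 else 0)) \<and>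
     (\<forall>f\<in>H1_circle. \<forall>e>0. \<exists>N a. H1_dist \<epsilon> f (lin_comb g N a) < e)"

definition PL :: "nat \<Rightarrow> (real \<Rightarrow> real) set" where
  "PL n = {f \<in> C_circle. \<forall>j\<in>{1..2^n::nat}. \<exists>a b.
     \<forall>x\<in>{(real j - 1) / 2^n ..< real j / 2^n}. f x = a * x + b}"

text \<open>
  The Borel sigma-algebra of \<open>PL n\<close> as a subspace of the Sobolev space.
\<close>

definition PL_borel :: "real \<Rightarrow> nat \<Rightarrow> (real \<Rightarrow> real) measure" where
  "PL_borel \<epsilon> n = sigma (PL n) {U. Metric_space.mopen (PL n) (H1_dist \<epsilon>) U}"

text \<open>
  Here \<open>X N j\<close> is the coefficient of the basis function \<open>g j\<close> at level \<open>N\<close>.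
\<close>

definition V :: "(nat \<Rightarrow> real \<Rightarrow> real) \<Rightarrow> (nat \<Rightarrow> nat \<Rightarrow> 'w \<Rightarrow> real) \<Rightarrow> nat \<Rightarrow> 'w \<Rightarrow> real \<Rightarrow> real" where
  "V g X n \<omega> = (\<lambda>x. (\<Sum>j=1..2^n. X (2^n) j \<omega> * g j x) + 1)"

definition \<nu> :: "real \<Rightarrow> (nat \<Rightarrow> real \<Rightarrow> real) \<Rightarrow> 'w measure \<Rightarrow> (nat \<Rightarrow> nat \<Rightarrow> 'w \<Rightarrow> real) \<Rightarrow> nat
    \<Rightarrow> (real \<Rightarrow> real) measure" where
  "\<nu> \<epsilon> g M X n = distr M (PL_borel \<epsilon> n) (V g X n)"

text \<open>
  Vectors with \<open>N\<close> real components are extensional functions on \<open>{1..N}\<close>; the product of the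
  measures \<open>lborel\<close> is Lebesgue measure on them.
\<close>

definition \<J> :: "(nat \<Rightarrow> real \<Rightarrow> real) \<Rightarrow> nat \<Rightarrow> (real \<Rightarrow> real) \<Rightarrow> nat \<Rightarrow> real" where
  "\<J> g n f = (THE a. a \<in> extensional {1..2^n} \<and> f = lin_comb g (2^n) a)"

definition lebesgue_N :: "nat \<Rightarrow> (nat \<Rightarrow> real) measure" where
  "lebesgue_N N = (\<Pi>\<^sub>M j\<in>{1..N}. lborel)"

end

theory Submission
  imports Defs
begin

text \<open>
  The constant function 1 is piecewise linear, so \<open>1 = (\<Sum>j. b j * g j)\<close> for some vector \<open>b\<close>, and
  the coordinates of \<open>V g X n\<close> are \<open>X (2^n) j + b j\<close>. These are independent normal variables with
  means \<open>b j\<close> and variance 1, so their joint density with respect to Lebesgue measure is a constant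
  times \<open>exp (- 1/2 * (\<Sum>j. (a j - b j)\<^sup>2))\<close> (lemmas \<open>distributed_indep_normal\<close> and
  \<open>prod_normal_density\<close>). For \<open>v = (\<Sum>j. a j * g j)\<close>, orthonormality identifies the sum of squares
  with the squared Sobolev norm of \<open>v - 1\<close>. Since the weak derivative of a constant vanishes, this is
  the stated energy (lemma \<open>shifted_energy\<close>).
  
  Two points need work. First, the weak derivative is an arbitrarily chosen one, so the bilinearity
  of \<open>H1_inner\<close> requires weak derivatives to be unique almost everywhere. This is the fundamental
  lemma of the calculus of variations, \<open>AE_eq_0_if_orthogonal_test_funs\<close>: logistic functions of
  \<open>cos (2\<pi>(x - m)) - d\<close> are test functions that converge boundedly to indicators of arcs, and the arcs
  determine an integrable function up to null sets.
  
  Second, the law of \<open>V g X n\<close> lives on the Borel sets of \<open>PL n\<close> for the Sobolev distance, so both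
  \<open>V g X n\<close> and the coordinate map must be shown measurable for these. This follows because the
  coordinate map is an isometry onto Euclidean space (lemma \<open>H1_dist_comb\<close>).
\<close>

section \<open>Test functions approximating indicators of arcs\<close>

text \<open>
  The algebra of functions generated by the constants, the sine and cosine of \<open>2\<pi>(x - m)\<close>, and the
  logistic function of \<open>n (cos (2\<pi>(x - m)) - d)\<close>. The logistic function \<open>s\<close> satisfies
  \<open>s' = s (1 - s)\<close>, so the algebra is closed under differentiation; hence all its members are
  smooth. As \<open>n\<close> grows, the logistic generator tends, off the end points, to the indicator of the arc
  around \<open>m\<close> on which \<open>cos (2\<pi>(x - m)) > d\<close>.
\<close>

inductive_set sigmoid_algebra :: "real \<Rightarrow> real \<Rightarrow> real \<Rightarrow> (real \<Rightarrow> real) set"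
  for m d n :: real
where
  const: "(\<lambda>x. c) \<in> sigmoid_algebra m d n"
| sin: "(\<lambda>x. sin (2 * pi * (x - m))) \<in> sigmoid_algebra m d n"
| cos: "(\<lambda>x. cos (2 * pi * (x - m))) \<in> sigmoid_algebra m d n"
| sigmoid: "(\<lambda>x. inverse (1 + exp (- (n * (cos (2 * pi * (x - m)) - d))))) \<in> sigmoid_algebra m d n"
| add: "f \<in> sigmoid_algebra m d n \<Longrightarrow> h \<in> sigmoid_algebra m d n \<Longrightarrow>
    (\<lambda>x. f x + h x) \<in> sigmoid_algebra m d n"
| mult: "f \<in> sigmoid_algebra m d n \<Longrightarrow> h \<in> sigmoid_algebra m d n \<Longrightarrow>
    (\<lambda>x. f x * h x) \<in> sigmoid_algebra m d n"

lemma sigmoid_algebra_deriv: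
  assumes "f \<in> sigmoid_algebra m d n"
  shows "\<exists>f'\<in>sigmoid_algebra m d n. \<forall>x. (f has_real_derivative f' x) (at x)"
  using assms
proof induction
  case (const c)
  show ?case by (rule bexI[OF _ sigmoid_algebra.const[of 0]]) simp
next
  case sin
  show ?case
    by (rule bexI[OF _ sigmoid_algebra.mult[OF sigmoid_algebra.const[of "2 * pi"] sigmoid_algebra.cos]])
       (auto intro!: derivative_eq_intros)
next
  case cos
  show ?case
    by (rule bexI[OF _ sigmoid_algebra.mult[OF sigmoid_algebra.const[of "- 2 * pi"] sigmoid_algebra.sin]])
       (auto intro!: derivative_eq_intros)
next
  case sigmoid
  define s where "s = (\<lambda>x. inverse (1 + exp (- (n * (cos (2 * pi * (x - m)) - d)))))"
  have s: "s \<in> sigmoid_algebra m d n" unfolding s_def by (rule sigmoid_algebra.sigmoid)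
  define s' where "s' = (\<lambda>x. (- 2 * pi * n) * (sin (2 * pi * (x - m)) * (s x * (1 + (-1) * s x))))"
  have s': "s' \<in> sigmoid_algebra m d n"
    unfolding s'_def by (intro sigmoid_algebra.intros s)
  have "(s has_real_derivative s' x) (at x)" for x
  proof -
    define E where "E = exp (- (n * (cos (2 * pi * (x - m)) - d)))"
    have E: "1 + E > 0" unfolding E_def by (simp add: add_pos_pos)
    have sx: "s x = inverse (1 + E)" by (simp add: s_def E_def)
    have "(s has_real_derivative
        - (inverse (1 + E) * (E * (2 * pi * n * sin (2 * pi * (x - m)))) * inverse (1 + E))) (at x)"
      unfolding s_def E_def
      by (rule derivative_eq_intros refl | use E in \<open>simp add: E_def\<close>)+
    moreover have "E * inverse (1 + E) = 1 - inverse (1 + E)"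
      using E by (simp add: field_simps)
    then have "- 2 * pi * n * (sin (2 * pi * (x - m)) * (inverse (1 + E) * (E * inverse (1 + E)))) = s' x"
      unfolding s'_def sx by simp
    then have "- (inverse (1 + E) * (E * (2 * pi * n * sin (2 * pi * (x - m)))) * inverse (1 + E)) = s' x"
      by (simp add: mult_ac)
    ultimately show ?thesis by simp
  qed
  with s' show ?case unfolding s_def by blast
next
  case (add f h)
  then obtain f' h' where "f' \<in> sigmoid_algebra m d n" "\<And>x. (f has_real_derivative f' x) (at x)"
    "h' \<in> sigmoid_algebra m d n" "\<And>x. (h has_real_derivative h' x) (at x)" by blast
  then show ?case
    by (intro bexI[of _ "\<lambda>x. f' x + h' x"]) (auto intro!: derivative_intros sigmoid_algebra.add)
next
  case (mult f h)
  then obtain f' h' where "f' \<in> sigmoid_algebra m d n" "\<And>x. (f has_real_derivative f' x) (at x)"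
    "h' \<in> sigmoid_algebra m d n" "\<And>x. (h has_real_derivative h' x) (at x)" by blast
  with mult show ?case
    by (intro bexI[of _ "\<lambda>x. f' x * h x + h' x * f x"])
       (auto intro!: DERIV_mult sigmoid_algebra.add sigmoid_algebra.mult)
qed

lemma sigmoid_algebra_test_fun:
  assumes "f \<in> sigmoid_algebra m d n"
  shows "test_fun f"
proof -
  have per: "sin (2 * pi * (x + 1 - m)) = sin (2 * pi * (x - m))"
    "cos (2 * pi * (x + 1 - m)) = cos (2 * pi * (x - m))" for x
    using sin_periodic[of "2 * pi * (x - m)"] cos_periodic[of "2 * pi * (x - m)"]
    by (simp_all add: algebra_simps)
  have "periodic1 f"
    using assms by induction (simp_all add: periodic1_def per)
  moreover have "(deriv ^^ k) f \<in> sigmoid_algebra m d n" for k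
  proof (induction k)
    case (Suc k)
    then obtain f' where "f' \<in> sigmoid_algebra m d n"
      and "\<And>x. ((deriv ^^ k) f has_real_derivative f' x) (at x)"
      using sigmoid_algebra_deriv by blast
    moreover from this have "deriv ((deriv ^^ k) f) = f'"
      by (intro ext DERIV_imp_deriv)
    ultimately show ?case by simp
  qed (simp add: assms)
  then have "(deriv ^^ k) f differentiable_on UNIV" for k
    using sigmoid_algebra_deriv
    unfolding differentiable_on_def by (metis field_differentiable_def
      field_differentiable_imp_differentiable differentiable_at_withinI)
  ultimately show ?thesis by (simp add: test_fun_def)
qed

lemma cos_less_cos_arc:
  assumes "0 \<le> s" "s < t" "t < 2 * pi - s"
  shows "cos t < cos s"
proof (cases "t \<le> pi")
  case True
  with assms show ?thesis by (intro cos_monotone_0_pi) auto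
next
  case False
  have "cos (2 * pi - t) < cos s"
    using assms False by (intro cos_monotone_0_pi) auto
  then show ?thesis by (simp add: cos_diff)
qed

lemma sigmoid_tendsto:
  fixes q :: real
  shows "q > 0 \<Longrightarrow> (\<lambda>n. inverse (1 + exp (- (real n * q)))) \<longlonglongrightarrow> 1"
    and "q < 0 \<Longrightarrow> (\<lambda>n. inverse (1 + exp (- (real n * q)))) \<longlonglongrightarrow> 0"
  by real_asymp+

section \<open>The fundamental lemma of the calculus of variations on the circle\<close>

lemma prob_space_circle: "prob_space circle_measure"
  unfolding circle_measure_def
  by (rule prob_space_restrict_space) auto

lemma space_circle [simp]: "space circle_measure = {0..<1}"
  by (simp add: circle_measure_def space_restrict_space)

lemma measurable_circle:
  "f \<in> borel_measurable borel \<Longrightarrow> f \<in> borel_measurable circle_measure"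
  unfolding circle_measure_def by (simp add: measurable_restrict_space1)

lemma AE_circle_iff: "(AE x in circle_measure. P x) \<longleftrightarrow> (AE x in lborel. x \<in> {0..<1} \<longrightarrow> P x)"
  unfolding circle_measure_def by (simp add: AE_restrict_space_iff)

lemma AE_circle_neq: "AE x in circle_measure. x \<noteq> c"
  unfolding AE_circle_iff using AE_lborel_singleton[of c] by eventually_elim auto

lemma L2_circle_integrable:
  assumes "f \<in> L2_circle"
  shows "integrable circle_measure f"
proof -
  interpret prob_space circle_measure by (rule prob_space_circle)
  show ?thesis
    using assms unfolding L2_circle_def
    by (auto intro: square_integrable_imp_integrable)
qed

text \<open>
  The indicator of an arc is the bounded pointwise limit, off the end points, of test functions, so
  a function orthogonal to all test functions has integral zero over the arc.
\<close>

lemma integral_arc_eq_0: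
  assumes f: "f \<in> L2_circle" and orth: "\<And>\<phi>. test_fun \<phi> \<Longrightarrow> L2_inner f \<phi> = 0"
    and ab: "0 \<le> a" "a < b" "b \<le> 1"
  shows "(LINT x|circle_measure. indicator {a<..<b} x * f x) = 0"
proof -
  \<comment> \<open>The arc has midpoint \<open>m\<close> and half-length \<open>(b - a) / 2\<close>, so it is where \<open>cos (2\<pi>(x - m)) > d\<close>.\<close>
  define m where "m = (a + b) / 2"
  define d where "d = cos (pi * (b - a))"
  define s where "s = (\<lambda>n x. inverse (1 + exp (- (real n * (cos (2 * pi * (x - m)) - d)))))"
  have cos_abs: "cos (2 * pi * (x - m)) = cos (2 * pi * \<bar>x - m\<bar>)" for x
    using cos_abs_real[of "2 * pi * (x - m)"] by (simp add: abs_mult)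
  have int: "integrable circle_measure f" using f by (rule L2_circle_integrable)
  then have [measurable]: "f \<in> borel_measurable circle_measure" by simp
  \<comment> \<open>The point 0 is excluded because it is an end point of the arc when \<open>b = 1\<close>.\<close>
  have lim: "(\<lambda>n. s n x) \<longlonglongrightarrow> indicator {a<..<b} x"
    if x: "x \<in> {0..<1}" "x \<noteq> 0" "x \<noteq> a" "x \<noteq> b" for x
  proof (cases "x \<in> {a<..<b}")
    case True
    have "cos (pi * (b - a)) < cos (2 * pi * \<bar>x - m\<bar>)"
    proof (rule cos_monotone_0_pi)
      have "2 * \<bar>x - m\<bar> < b - a" using True by (auto simp: m_def abs_if field_simps)
      from mult_strict_left_mono[OF this pi_gt_zero]
      show "2 * pi * \<bar>x - m\<bar> < pi * (b - a)" by (simp add: algebra_simps)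
      show "pi * (b - a) \<le> pi" using ab by (simp add: mult_left_le)
    qed simp
    then have "cos (2 * pi * (x - m)) - d > 0"
      by (simp add: d_def cos_abs)
    with True show ?thesis unfolding s_def by (simp add: sigmoid_tendsto(1))
  next
    case False
    have "cos (2 * pi * \<bar>x - m\<bar>) < cos (pi * (b - a))"
    proof (rule cos_less_cos_arc)
      have "b - a < 2 * \<bar>x - m\<bar>" using False x by (auto simp: m_def abs_if field_simps)
      from mult_strict_left_mono[OF this pi_gt_zero]
      show "pi * (b - a) < 2 * pi * \<bar>x - m\<bar>" by (simp add: algebra_simps)
      have "2 * \<bar>x - m\<bar> < 2 - (b - a)" using ab x by (auto simp: m_def abs_if field_simps)
      from mult_strict_left_mono[OF this pi_gt_zero]
      show "2 * pi * \<bar>x - m\<bar> < 2 * pi - pi * (b - a)" by (simp add: algebra_simps)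
    qed (use ab in simp)
    then have "cos (2 * pi * (x - m)) - d < 0"
      by (simp add: d_def cos_abs)
    with False show ?thesis unfolding s_def by (simp add: sigmoid_tendsto(2))
  qed
  have "(\<lambda>n. LINT x|circle_measure. s n x * f x) \<longlonglongrightarrow>
      (LINT x|circle_measure. indicator {a<..<b} x * f x)"
  proof (rule integral_dominated_convergence)
    show "integrable circle_measure (\<lambda>x. \<bar>f x\<bar>)" using int by simp
    have [measurable]: "indicator {a<..<b} \<in> borel_measurable circle_measure"
      by (rule measurable_circle) measurable
    have [measurable]: "s n \<in> borel_measurable circle_measure" for n
      unfolding s_def by (rule measurable_circle) measurable
    show "(\<lambda>x. s n x * f x) \<in> borel_measurable circle_measure" for n by measurable
    show "(\<lambda>x. indicator {a<..<b} x * f x) \<in> borel_measurable circle_measure" by measurable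
    have "0 \<le> s n x \<and> s n x \<le> 1" for n x
      unfolding s_def by (simp add: add_nonneg_nonneg inverse_le_1_iff)
    then show "AE x in circle_measure. norm (s n x * f x) \<le> \<bar>f x\<bar>" for n
      by (intro AE_I2) (auto simp: abs_mult intro!: mult_left_le_one_le)
    show "AE x in circle_measure. (\<lambda>n. s n x * f x) \<longlonglongrightarrow> indicator {a<..<b} x * f x"
      using AE_circle_neq[of 0] AE_circle_neq[of a] AE_circle_neq[of b] AE_space
      by eventually_elim (intro tendsto_intros lim; simp)
  qed
  moreover have "(LINT x|circle_measure. s n x * f x) = 0" for n
  proof -
    have "test_fun (s n)"
      unfolding s_def by (rule sigmoid_algebra_test_fun[OF sigmoid_algebra.sigmoid])
    from orth[OF this] show ?thesis by (simp add: L2_inner_def mult.commute)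
  qed
  ultimately show ?thesis by (simp add: LIMSEQ_const_iff)
qed

text \<open>
  The Borel sets over which \<open>f\<close> has integral zero form a Dynkin system, which contains the
  intersection-stable generator of open intervals by \<open>integral_arc_eq_0\<close>.
\<close>

lemma AE_eq_0_if_orthogonal_test_funs:
  assumes f: "f \<in> L2_circle" and orth: "\<And>\<phi>. test_fun \<phi> \<Longrightarrow> L2_inner f \<phi> = 0"
  shows "AE x in circle_measure. f x = 0"
proof -
  interpret prob_space circle_measure by (rule prob_space_circle)
  have int: "integrable circle_measure f" using f by (rule L2_circle_integrable)
  then have [measurable]: "f \<in> borel_measurable circle_measure" by simp
  have "test_fun (\<lambda>x. 1)"
    by (rule sigmoid_algebra_test_fun[where m = 0 and d = 0 and n = 0]) (rule sigmoid_algebra.const)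
  from orth[OF this] have total: "(LINT x|circle_measure. f x) = 0" by (simp add: L2_inner_def)
  have msb: "A \<in> sets borel \<Longrightarrow> (\<lambda>x. indicator A x :: real) \<in> borel_measurable circle_measure" for A :: "real set"
    by (intro measurable_circle borel_measurable_indicator)
  have ii: "integrable circle_measure (\<lambda>x. indicator A x * f x)" if "A \<in> sets borel" for A
    using int by (rule Bochner_Integration.integrable_bound)
      (use msb[OF that] in \<open>auto intro!: AE_I2 split: split_indicator\<close>)
  have borel_intervals: "sets borel = sigma_sets UNIV (range (\<lambda>(a, b). {a<..<b :: real}))"
    by (simp add: borel_eq_box)
  have zero: "(LINT x|circle_measure. indicator A x * f x) = 0" if "A \<in> sets borel" for A :: "real set"
  proof -
    have "Int_stable (range (\<lambda>(a, b). {a<..<b :: real}))"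
      by (auto simp: Int_stable_def)
    moreover have "range (\<lambda>(a, b). {a<..<b :: real}) \<subseteq> Pow UNIV" by simp
    moreover have "A \<in> sigma_sets UNIV (range (\<lambda>(a, b). {a<..<b :: real}))"
      using that by (simp add: borel_intervals)
    ultimately show ?thesis
    proof (induction rule: sigma_sets_induct_disjoint)
      case (basic A)
      then obtain a b where A: "A = {a<..<b}" by auto
      \<comment> \<open>Within \<open>{0..<1}\<close> the two intervals can differ only at the null point 0.\<close>
      define a' b' where "a' = max a 0" and "b' = min b 1"
      have "(LINT x|circle_measure. indicator A x * f x) = (LINT x|circle_measure. indicator {a'<..<b'} x * f x)"
      proof (rule integral_cong_AE)
        show "AE x in circle_measure. indicator A x * f x = indicator {a'<..<b'} x * f x"
          using AE_circle_neq[of 0] AE_space[of circle_measure]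
          by eventually_elim (auto simp: A a'_def b'_def split: split_indicator)
      qed (use msb[of A] msb[of "{a'<..<b'}"] A in \<open>auto intro!: borel_measurable_times\<close>)
      also have "\<dots> = 0"
      proof (cases "a' < b'")
        case True
        then show ?thesis by (intro integral_arc_eq_0 f orth) (auto simp: a'_def b'_def)
      qed simp
      finally show ?case .
    next
      case empty
      show ?case by simp
    next
      case (compl A)
      then have A: "A \<in> sets borel" by (simp add: borel_intervals)
      have "(LINT x|circle_measure. indicator (UNIV - A) x * f x)
          = (LINT x|circle_measure. f x - indicator A x * f x)"
        by (intro Bochner_Integration.integral_cong refl) (auto split: split_indicator)
      then show ?case using compl total ii[OF A] int by simp
    next
      case (union A)
      then have A: "A i \<in> sets borel" for i
        by (auto simp: borel_intervals)
      have "(\<lambda>i. LINT x|circle_measure. (\<Sum>j<i. indicator (A j) x * f x)) \<longlonglongrightarrow>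
          (LINT x|circle_measure. indicator (\<Union>i. A i) x * f x)"
      proof (rule integral_dominated_convergence)
        show "integrable circle_measure (\<lambda>x. \<bar>f x\<bar>)" using int by simp
        show "(\<lambda>x. \<Sum>j<i. indicator (A j) x * f x) \<in> borel_measurable circle_measure" for i
          using A msb by (intro borel_measurable_sum borel_measurable_times) auto
        show "(\<lambda>x. indicator (\<Union>i. A i) x * f x) \<in> borel_measurable circle_measure"
          using A msb[of "\<Union>i. A i"] by (intro borel_measurable_times) auto
        have ind: "(\<Sum>j<i. indicator (A j) x :: real) = indicator (\<Union>j<i. A j) x" for i x
          using union(1) by (intro indicator_UN_disjoint[symmetric]) (auto simp: disjoint_family_on_def)
        show "AE x in circle_measure. norm (\<Sum>j<i. indicator (A j) x * f x) \<le> \<bar>f x\<bar>" for i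
          unfolding sum_distrib_right[symmetric] ind
          by (intro AE_I2) (auto split: split_indicator)
        have "(\<lambda>i. indicator (\<Union>j<i. A j) x :: real) \<longlonglongrightarrow> indicator (\<Union>i. A i) x" for x
          by (rule LIMSEQ_indicator_UN)
        then show "AE x in circle_measure. (\<lambda>i. \<Sum>j<i. indicator (A j) x * f x) \<longlonglongrightarrow> indicator (\<Union>i. A i) x * f x"
          unfolding sum_distrib_right[symmetric] ind by (intro AE_I2 tendsto_intros) auto
      qed
      moreover have "(LINT x|circle_measure. (\<Sum>j<i. indicator (A j) x * f x)) = 0" for i
        using union ii[OF A] by (subst Bochner_Integration.integral_sum) auto
      ultimately show ?case by (simp add: LIMSEQ_const_iff)
    qed
  qed
  show ?thesis
  proof (rule density_zero[OF int])
    fix A assume "A \<in> sets circle_measure"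
    then have "A \<in> sets borel" by (auto simp: circle_measure_def sets_restrict_space)
    from zero[OF this] show "set_lebesgue_integral circle_measure A f = 0"
      by (simp add: set_lebesgue_integral_def)
  qed
qed

section \<open>Weak derivatives and the bilinear form\<close>

lemma L2_circle_measurable: "f \<in> L2_circle \<Longrightarrow> f \<in> borel_measurable circle_measure"
  by (simp add: L2_circle_def)

lemma L2_circle_integrable_mult:
  assumes "f \<in> L2_circle" "h \<in> L2_circle"
  shows "integrable circle_measure (\<lambda>x. f x * h x)"
proof (rule Bochner_Integration.integrable_bound)
  show "integrable circle_measure (\<lambda>x. (f x)\<^sup>2 + (h x)\<^sup>2)"
    using assms by (simp add: L2_circle_def)
  show "(\<lambda>x. f x * h x) \<in> borel_measurable circle_measure"
    using assms by (intro borel_measurable_times L2_circle_measurable)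
  have "\<bar>u * v\<bar> \<le> u\<^sup>2 + v\<^sup>2" for u v :: real
  proof -
    have "2 * \<bar>u\<bar> * \<bar>v\<bar> \<le> \<bar>u\<bar>\<^sup>2 + \<bar>v\<bar>\<^sup>2" by (rule sum_squares_bound)
    moreover have "0 \<le> \<bar>u\<bar> * \<bar>v\<bar>" by simp
    ultimately show ?thesis unfolding abs_mult power2_abs by linarith
  qed
  then show "AE x in circle_measure. norm (f x * h x) \<le> norm ((f x)\<^sup>2 + (h x)\<^sup>2)"
    by (intro AE_I2) simp
qed

lemma L2_circle_lin:
  assumes "f \<in> L2_circle" "h \<in> L2_circle"
  shows "(\<lambda>x. a * f x + b * h x) \<in> L2_circle"
proof -
  have "(\<lambda>x. (a * f x + b * h x)\<^sup>2) = (\<lambda>x. a\<^sup>2 * (f x)\<^sup>2 + 2 * a * b * (f x * h x) + b\<^sup>2 * (h x)\<^sup>2)"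
    by (simp add: fun_eq_iff power2_eq_square algebra_simps)
  then show ?thesis
    using assms L2_circle_integrable_mult[OF assms]
    by (auto simp: L2_circle_def intro!: borel_measurable_add borel_measurable_times)
qed

lemma L2_inner_lin_left:
  assumes "f \<in> L2_circle" "h \<in> L2_circle" "k \<in> L2_circle"
  shows "L2_inner (\<lambda>x. a * f x + b * h x) k = a * L2_inner f k + b * L2_inner h k"
proof -
  have "L2_inner (\<lambda>x. a * f x + b * h x) k
      = (LINT x|circle_measure. a * (f x * k x) + b * (h x * k x))"
    unfolding L2_inner_def by (simp add: algebra_simps)
  then show ?thesis
    using assms L2_circle_integrable_mult by (simp add: L2_inner_def)
qed

lemma L2_inner_commute: "L2_inner f h = L2_inner h f"
  unfolding L2_inner_def by (simp add: mult.commute)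

lemma L2_inner_nonneg: "0 \<le> L2_inner f f"
  unfolding L2_inner_def by simp

lemma L2_inner_minus_left: "L2_inner (\<lambda>x. - f x) h = - L2_inner f h"
  unfolding L2_inner_def by simp

lemma L2_inner_cong_AE:
  assumes "f \<in> L2_circle" "f' \<in> L2_circle" "h \<in> L2_circle" "h' \<in> L2_circle"
    and "AE x in circle_measure. f x = f' x" "AE x in circle_measure. h x = h' x"
  shows "L2_inner f h = L2_inner f' h'"
  unfolding L2_inner_def
proof (rule integral_cong_AE)
  show "AE x in circle_measure. f x * h x = f' x * h' x"
    using assms(5,6) by eventually_elim simp
qed (use assms L2_circle_measurable in auto)

lemma continuous_L2_circle:
  assumes "continuous_on UNIV f"
  shows "f \<in> L2_circle"
proof -
  interpret prob_space circle_measure by (rule prob_space_circle)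
  have meas: "f \<in> borel_measurable circle_measure"
    using assms by (intro measurable_circle borel_measurable_continuous_onI)
  have "compact ((\<lambda>x. (f x)\<^sup>2) ` {0..1})"
    by (intro compact_continuous_image continuous_intros continuous_on_subset[OF assms]) auto
  then obtain B where B: "\<And>x. x \<in> {0..1} \<Longrightarrow> norm ((f x)\<^sup>2) \<le> B"
    by (meson compact_imp_bounded bounded_iff imageI)
  have "integrable circle_measure (\<lambda>x. (f x)\<^sup>2)"
    using B meas by (intro integrable_const_bound[where B = B] AE_I2) auto
  with meas show ?thesis by (simp add: L2_circle_def)
qed

lemma C_circle_L2: "f \<in> C_circle \<Longrightarrow> f \<in> L2_circle"
  by (simp add: C_circle_def continuous_L2_circle)

lemma test_fun_L2:
  assumes "test_fun \<phi>"
  shows "\<phi> \<in> L2_circle" "deriv \<phi> \<in> L2_circle"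
proof -
  have "(deriv ^^ 0) \<phi> differentiable_on UNIV" "(deriv ^^ 1) \<phi> differentiable_on UNIV"
    using assms unfolding test_fun_def by blast+
  then show "\<phi> \<in> L2_circle" "deriv \<phi> \<in> L2_circle"
    by (auto intro: continuous_L2_circle differentiable_imp_continuous_on)
qed

text \<open>
  Uniqueness makes the integrals in \<open>H1_inner\<close> independent of the representative that \<open>wderiv\<close>
  chooses; bilinearity of \<open>H1_inner\<close> rests on it.
\<close>

lemma weak_deriv_unique:
  assumes h: "weak_deriv f h" and k: "weak_deriv f k"
  shows "AE x in circle_measure. h x = k x"
proof -
  have L2: "h \<in> L2_circle" "k \<in> L2_circle" using assms by (auto simp: weak_deriv_def)
  have "AE x in circle_measure. 1 * h x + (-1) * k x = 0"
  proof (rule AE_eq_0_if_orthogonal_test_funs)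
    show "(\<lambda>x. 1 * h x + (-1) * k x) \<in> L2_circle" using L2 by (rule L2_circle_lin)
    fix \<phi> assume \<phi>: "test_fun \<phi>"
    then have "L2_inner h \<phi> = L2_inner k \<phi>" using h k by (simp add: weak_deriv_def)
    then show "L2_inner (\<lambda>x. 1 * h x + (-1) * k x) \<phi> = 0"
      by (simp only: L2_inner_lin_left[OF L2 test_fun_L2(1)[OF \<phi>]])
  qed
  then show ?thesis by simp
qed

lemma weak_deriv_lin:
  assumes "f \<in> C_circle" "h \<in> C_circle" and f': "weak_deriv f f'" and h': "weak_deriv h h'"
  shows "weak_deriv (\<lambda>x. a * f x + b * h x) (\<lambda>x. a * f' x + b * h' x)"
  unfolding weak_deriv_def
proof (intro conjI allI impI)
  have L2: "f' \<in> L2_circle" "h' \<in> L2_circle" using f' h' by (auto simp: weak_deriv_def)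
  then show "(\<lambda>x. a * f' x + b * h' x) \<in> L2_circle" by (rule L2_circle_lin)
  fix \<phi> assume \<phi>: "test_fun \<phi>"
  then have "L2_inner f (deriv \<phi>) = - L2_inner f' \<phi>" "L2_inner h (deriv \<phi>) = - L2_inner h' \<phi>"
    using f' h' by (auto simp: weak_deriv_def)
  then show "L2_inner (\<lambda>x. a * f x + b * h x) (deriv \<phi>) = - L2_inner (\<lambda>x. a * f' x + b * h' x) \<phi>"
    using assms L2 test_fun_L2[OF \<phi>] by (simp add: L2_inner_lin_left C_circle_L2)
qed

lemma weak_deriv_minus:
  assumes "weak_deriv f h"
  shows "weak_deriv (\<lambda>x. - f x) (\<lambda>x. - h x)"
  using assms by (auto simp: weak_deriv_def L2_inner_minus_left L2_circle_def)

lemma integral_circle_deriv_test_fun: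
  assumes "test_fun \<phi>"
  shows "(LINT x|circle_measure. deriv \<phi> x) = 0"
proof -
  have diff: "(deriv ^^ 0) \<phi> differentiable_on UNIV" "(deriv ^^ 1) \<phi> differentiable_on UNIV"
    using assms unfolding test_fun_def by blast+
  have "continuous_on UNIV (deriv \<phi>)"
    using diff(2) by (auto intro: differentiable_imp_continuous_on)
  then have cont: "isCont (deriv \<phi>) x" for x by (simp add: continuous_on_eq_continuous_at)
  have "\<phi> differentiable at x" for x using diff(1) by (simp add: differentiable_on_def)
  then have D: "DERIV \<phi> x :> deriv \<phi> x" for x
    by (simp add: DERIV_deriv_iff_real_differentiable)
  have "(LINT x|circle_measure. deriv \<phi> x) = (LINT x|lborel. deriv \<phi> x * indicator {0..1} x)"
    unfolding circle_measure_def
  proof (subst integral_restrict_space, simp, rule integral_cong_AE)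
    have [measurable]: "deriv \<phi> \<in> borel_measurable borel"
      using \<open>continuous_on UNIV (deriv \<phi>)\<close> by (rule borel_measurable_continuous_onI)
    show "(\<lambda>x. indicator {0..<1} x *\<^sub>R deriv \<phi> x) \<in> borel_measurable lborel"
      "(\<lambda>x. deriv \<phi> x * indicator {0..1} x) \<in> borel_measurable lborel" by measurable
    show "AE x in lborel. indicator {0..<1} x *\<^sub>R deriv \<phi> x = deriv \<phi> x * indicator {0..1} x"
      using AE_lborel_singleton[of 1] by eventually_elim (auto split: split_indicator)
  qed
  also have "\<dots> = \<phi> 1 - \<phi> 0"
    using D cont by (intro integral_FTC_Icc_real) auto
  also have "\<dots> = 0"
    using assms by (simp add: test_fun_def periodic1_def) (metis add_0 diff_self)
  finally show ?thesis .
qed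

lemma weak_deriv_const: "weak_deriv (\<lambda>x. c) (\<lambda>x. 0)"
  by (simp add: weak_deriv_def L2_inner_def L2_circle_def integral_circle_deriv_test_fun)

lemma weak_deriv_wderiv: "weak_deriv f h \<Longrightarrow> weak_deriv f (wderiv f)"
  unfolding wderiv_def by (rule someI[of "weak_deriv f"])

lemma H1_inner_eq:
  assumes f: "weak_deriv f f'" and h: "weak_deriv h h'"
  shows "H1_inner \<epsilon> f h = 1 / (4 * \<epsilon>) * L2_inner f h + \<epsilon> * L2_inner f' h'"
proof -
  have wf: "weak_deriv f (wderiv f)" and wh: "weak_deriv h (wderiv h)"
    using f h weak_deriv_wderiv by blast+
  have "L2_inner (wderiv f) (wderiv h) = L2_inner f' h'"
    using f h wf wh weak_deriv_unique[OF wf f] weak_deriv_unique[OF wh h]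
    by (intro L2_inner_cong_AE) (auto simp: weak_deriv_def)
  then show ?thesis by (simp add: H1_inner_def)
qed

lemma H1_inner_commute: "H1_inner \<epsilon> f h = H1_inner \<epsilon> h f"
  by (simp add: H1_inner_def L2_inner_commute)

text \<open>
  No assumption on \<open>f\<close> is made: the locale \<open>Metric_space\<close> demands that the distance be symmetric on
  the whole type and not only on the carrier. If \<open>f\<close> has no weak derivative, neither has \<open>- f\<close>, and
  both values of \<open>wderiv\<close> are the same unspecified function.
\<close>

lemma H1_inner_minus_minus: "H1_inner \<epsilon> (\<lambda>x. - f x) (\<lambda>x. - f x) = H1_inner \<epsilon> f f"
proof (cases "\<exists>h. weak_deriv f h")
  case True
  then obtain h where h: "weak_deriv f h" ..
  show ?thesis
    unfolding H1_inner_eq[OF h h] H1_inner_eq[OF weak_deriv_minus[OF h] weak_deriv_minus[OF h]]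
    by (simp add: L2_inner_def)
next
  case False
  then have none: "weak_deriv f h = False" for h by auto
  have "weak_deriv (\<lambda>x. - f x) h = False" for h
    using weak_deriv_minus[of "\<lambda>x. - f x" h] none by auto
  then have "wderiv (\<lambda>x. - f x) = wderiv f" using none by (simp add: wderiv_def)
  then show ?thesis by (simp add: H1_inner_def L2_inner_def)
qed

lemma H1_inner_nonneg: "\<epsilon> > 0 \<Longrightarrow> 0 \<le> H1_inner \<epsilon> f f"
  by (simp add: H1_inner_def L2_inner_nonneg)

lemma H1_circle_weak_deriv: "f \<in> H1_circle \<Longrightarrow> weak_deriv f (wderiv f)"
  by (auto simp: H1_circle_def intro: weak_deriv_wderiv)

lemma H1_circle_lin:
  assumes "f \<in> H1_circle" "h \<in> H1_circle"
  shows "(\<lambda>x. a * f x + b * h x) \<in> H1_circle"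
proof -
  have "(\<lambda>x. a * f x + b * h x) \<in> C_circle"
    using assms by (auto simp: H1_circle_def C_circle_def periodic1_def intro!: continuous_intros)
  then show ?thesis
    using assms weak_deriv_lin by (fastforce simp: H1_circle_def)
qed

lemma H1_inner_lin_left:
  assumes "f \<in> H1_circle" "h \<in> H1_circle" "k \<in> H1_circle"
  shows "H1_inner \<epsilon> (\<lambda>x. a * f x + b * h x) k = a * H1_inner \<epsilon> f k + b * H1_inner \<epsilon> h k"
proof -
  have w: "weak_deriv f (wderiv f)" "weak_deriv h (wderiv h)" "weak_deriv k (wderiv k)"
    and C: "f \<in> C_circle" "h \<in> C_circle" "k \<in> C_circle"
    using assms H1_circle_weak_deriv by (auto simp: H1_circle_def)
  then have L2: "wderiv f \<in> L2_circle" "wderiv h \<in> L2_circle" "wderiv k \<in> L2_circle"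
    by (auto simp: weak_deriv_def)
  show ?thesis
    unfolding H1_inner_eq[OF weak_deriv_lin[OF C(1,2) w(1,2)] w(3)]
    using L2 C by (simp add: L2_inner_lin_left C_circle_L2 H1_inner_def algebra_simps)
qed

lemma lin_comb_Suc:
  "lin_comb g (Suc N) a = (\<lambda>x. 1 * lin_comb g N a x + a (Suc N) * g (Suc N) x)"
  by (simp add: lin_comb_def)

lemma lin_comb_H1:
  assumes "\<And>j. j \<in> {1..N} \<Longrightarrow> g j \<in> H1_circle"
  shows "lin_comb g N a \<in> H1_circle"
  using assms
proof (induction N)
  case 0
  have "(\<lambda>x. 0) \<in> H1_circle"
    using weak_deriv_const by (auto simp: H1_circle_def C_circle_def periodic1_def)
  then show ?case by (simp add: lin_comb_def)
next
  case (Suc N)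
  show ?case unfolding lin_comb_Suc by (intro H1_circle_lin Suc) (use Suc.prems in auto)
qed

lemma H1_inner_lin_comb_left:
  assumes "\<And>j. j \<in> {1..N} \<Longrightarrow> g j \<in> H1_circle" and k: "k \<in> H1_circle"
  shows "H1_inner \<epsilon> (lin_comb g N a) k = (\<Sum>j=1..N. a j * H1_inner \<epsilon> (g j) k)"
  using assms(1)
proof (induction N)
  case 0
  have "H1_inner \<epsilon> (\<lambda>x. 0) k = 0"
    using H1_inner_eq[OF weak_deriv_const H1_circle_weak_deriv[OF k], of \<epsilon>] by (simp add: L2_inner_def)
  then show ?case by (simp add: lin_comb_def)
next
  case (Suc N)
  have "lin_comb g N a \<in> H1_circle" "g (Suc N) \<in> H1_circle"
    using Suc.prems by (auto intro: lin_comb_H1)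
  with k show ?case unfolding lin_comb_Suc using Suc by (subst H1_inner_lin_left) auto
qed

section \<open>Coordinates on the space of piecewise linear functions\<close>

text \<open>
  The \<open>2^n\<close> functions \<open>g 1, ..., g (2^n)\<close> are orthonormal for the bilinear form and their linear
  combinations are exactly the members of \<open>PL n\<close>. Completeness of the whole family plays no role
  at a fixed level \<open>n\<close>.
\<close>

locale PL_orthonormal_basis =
  fixes \<epsilon> :: real and g :: "nat \<Rightarrow> real \<Rightarrow> real" and n :: nat
  assumes eps: "\<epsilon> > 0"
    and g_H1: "\<And>j. j \<in> {1..2^n} \<Longrightarrow> g j \<in> H1_circle"
    and orthonormal: "\<And>i j. i \<in> {1..2^n} \<Longrightarrow> j \<in> {1..2^n} \<Longrightarrow>
      H1_inner \<epsilon> (g i) (g j) = (if i = j then 1 else 0)"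
    and span: "range (lin_comb g (2^n)) = PL n"
begin

abbreviation "comb \<equiv> lin_comb g (2^n)"

lemma comb_H1: "comb a \<in> H1_circle"
  by (rule lin_comb_H1) (rule g_H1)

lemma comb_PL: "comb a \<in> PL n"
  using span by blast

lemma H1_inner_comb: "H1_inner \<epsilon> (comb a) (comb b) = (\<Sum>j=1..2^n. a j * b j)"
proof -
  have "H1_inner \<epsilon> (comb a) (comb b) = (\<Sum>j=1..2^n. a j * H1_inner \<epsilon> (g j) (comb b))"
    using g_H1 comb_H1 by (rule H1_inner_lin_comb_left)
  also have "\<dots> = (\<Sum>j=1..2^n. a j * b j)"
  proof (rule sum.cong[OF refl])
    fix j assume j: "j \<in> {1..2^n::nat}"
    have "H1_inner \<epsilon> (g j) (comb b) = H1_inner \<epsilon> (comb b) (g j)" by (rule H1_inner_commute)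
    also have "\<dots> = (\<Sum>i=1..2^n. b i * H1_inner \<epsilon> (g i) (g j))"
      using g_H1 g_H1[OF j] by (rule H1_inner_lin_comb_left)
    also have "\<dots> = (\<Sum>i=1..2^n. if i = j then b j else 0)"
      using j by (intro sum.cong) (auto simp: orthonormal)
    also have "\<dots> = b j" using j by simp
    finally show "a j * H1_inner \<epsilon> (g j) (comb b) = a j * b j" by simp
  qed
  finally show ?thesis .
qed

lemma comb_diff: "(\<lambda>x. comb a x - comb b x) = comb (\<lambda>j. a j - b j)"
  by (simp add: lin_comb_def sum_subtractf algebra_simps)

lemma comb_add: "(\<lambda>x. comb a x + comb b x) = comb (\<lambda>j. a j + b j)"
  by (simp add: lin_comb_def sum.distrib algebra_simps)

text \<open>
  The coordinate map is an isometry onto Euclidean space; hence it is a homeomorphism, and the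
  Borel sigma-algebras correspond.
\<close>

lemma H1_dist_comb: "H1_dist \<epsilon> (comb a) (comb b) = L2_set (\<lambda>j. a j - b j) {1..2^n}"
  by (simp add: H1_dist_def comb_diff H1_inner_comb L2_set_def power2_eq_square)

lemma comb_cong: "(\<And>j. j \<in> {1..2^n} \<Longrightarrow> a j = b j) \<Longrightarrow> comb a = comb b"
  by (auto simp: lin_comb_def intro!: sum.cong)

lemma comb_eq_iff: "comb a = comb b \<longleftrightarrow> (\<forall>j\<in>{1..2^n}. a j = b j)"
proof
  assume "comb a = comb b"
  moreover have "H1_dist \<epsilon> (comb b) (comb b) = 0" by (simp add: H1_dist_comb L2_set_def)
  ultimately have "L2_set (\<lambda>j. a j - b j) {1..2^n} = 0" using H1_dist_comb[of a b] by simp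
  then show "\<forall>j\<in>{1..2^n}. a j = b j" by (simp add: L2_set_eq_0_iff)
qed (use comb_cong in blast)

lemma coord_comb: "\<J> g n (comb a) = restrict a {1..2^n}"
  unfolding \<J>_def
proof (rule the_equality)
  show "restrict a {1..2^n} \<in> extensional {1..2^n} \<and> comb a = comb (restrict a {1..2^n})"
    by (auto intro: comb_cong)
  fix b assume "b \<in> extensional {1..2^n} \<and> comb a = comb b"
  then show "b = restrict a {1..2^n}" unfolding comb_eq_iff by (auto intro: extensionalityI)
qed

lemma PL_cases:
  assumes "f \<in> PL n"
  obtains a where "f = comb a"
  using assms span by blast

lemma Metric_space_PL: "Metric_space (PL n) (H1_dist \<epsilon>)"
proof
  fix f h k
  show "0 \<le> H1_dist \<epsilon> f h" using eps by (simp add: H1_dist_def H1_inner_nonneg)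
  show "H1_dist \<epsilon> f h = H1_dist \<epsilon> h f"
    using H1_inner_minus_minus[of \<epsilon> "\<lambda>x. f x - h x"] by (simp add: H1_dist_def)
  assume "f \<in> PL n" "h \<in> PL n"
  then obtain a b where f: "f = comb a" and h: "h = comb b" by (metis PL_cases)
  show "H1_dist \<epsilon> f h = 0 \<longleftrightarrow> f = h"
    unfolding f h H1_dist_comb comb_eq_iff by (simp add: L2_set_eq_0_iff)
  assume "k \<in> PL n"
  then obtain c where k: "k = comb c" by (metis PL_cases)
  show "H1_dist \<epsilon> f k \<le> H1_dist \<epsilon> f h + H1_dist \<epsilon> h k"
    unfolding f h k H1_dist_comb
    using L2_set_triangle_ineq[of "\<lambda>j. a j - b j" "\<lambda>j. b j - c j" "{1..2^n}"] by simp
qed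

lemma space_PL_borel [simp]: "space (PL_borel \<epsilon> n) = PL n"
  unfolding PL_borel_def by (rule space_measure_of_conv)

lemma sets_PL_borel:
  "sets (PL_borel \<epsilon> n) = sigma_sets (PL n) {U. Metric_space.mopen (PL n) (H1_dist \<epsilon>) U}"
  unfolding PL_borel_def
  by (rule sets_measure_of) (auto simp: Metric_space.mopen_def[OF Metric_space_PL])

text \<open>
  Each coordinate is 1-Lipschitz for the Sobolev distance.
\<close>

lemma coord_measurable:
  assumes j: "j \<in> {1..2^n}"
  shows "(\<lambda>f. \<J> g n f j) \<in> borel_measurable (PL_borel \<epsilon> n)"
proof (rule borel_measurableI)
  interpret PL: Metric_space "PL n" "H1_dist \<epsilon>" by (rule Metric_space_PL)
  fix S :: "real set" assume S: "open S"
  have "PL.mopen ((\<lambda>f. \<J> g n f j) -` S \<inter> PL n)"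
    unfolding PL.mopen_def
  proof (intro conjI allI impI)
    fix f assume f: "f \<in> (\<lambda>f. \<J> g n f j) -` S \<inter> PL n"
    then obtain a where a: "f = comb a" by (metis PL_cases IntD2)
    then have "a j \<in> S" using f j by (simp add: coord_comb)
    then obtain r where r: "r > 0" "ball (a j) r \<subseteq> S" using S open_contains_ball by blast
    have "PL.mball f r \<subseteq> (\<lambda>f. \<J> g n f j) -` S \<inter> PL n"
    proof
      fix h assume h: "h \<in> PL.mball f r"
      then obtain b where b: "h = comb b" by (metis PL_cases PL.in_mball)
      have "\<bar>a j - b j\<bar> \<le> L2_set (\<lambda>j. \<bar>a j - b j\<bar>) {1..2^n}"
        using j by (intro member_le_L2_set) auto
      also have "\<dots> = H1_dist \<epsilon> f h" by (simp add: a b H1_dist_comb L2_set_def)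
      also have "\<dots> < r" using h by simp
      finally have "b j \<in> S" using r(2) by (auto simp: dist_real_def subset_iff)
      then show "h \<in> (\<lambda>f. \<J> g n f j) -` S \<inter> PL n"
        using j by (simp add: b coord_comb comb_PL)
    qed
    with r show "\<exists>r>0. PL.mball f r \<subseteq> (\<lambda>f. \<J> g n f j) -` S \<inter> PL n" by blast
  qed auto
  then show "(\<lambda>f. \<J> g n f j) -` S \<inter> space (PL_borel \<epsilon> n) \<in> sets (PL_borel \<epsilon> n)"
    unfolding sets_PL_borel by (simp add: sigma_sets.Basic)
qed


end

section \<open>Independent normal variables\<close>

lemma PiM_density:
  fixes N :: "'i \<Rightarrow> 'a measure" and f :: "'i \<Rightarrow> 'a \<Rightarrow> ennreal"
  assumes I: "finite I"
    and N: "\<And>i. sigma_finite_measure (N i)"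
    and D: "\<And>i. sigma_finite_measure (density (N i) (f i))"
    and f [measurable]: "\<And>i. f i \<in> borel_measurable (N i)"
  shows "PiM I (\<lambda>i. density (N i) (f i)) = density (PiM I N) (\<lambda>x. \<Prod>i\<in>I. f i (x i))"
proof -
  interpret N: product_sigma_finite N using N by (simp add: product_sigma_finite_def)
  interpret D: product_sigma_finite "\<lambda>i. density (N i) (f i)"
    using D by (simp add: product_sigma_finite_def)
  have F: "(\<lambda>x. \<Prod>i\<in>I. f i (x i)) \<in> borel_measurable (PiM I N)"
    by measurable
  show ?thesis
  proof (rule D.PiM_eqI[OF I, symmetric])
    show "sets (density (PiM I N) (\<lambda>x. \<Prod>i\<in>I. f i (x i))) = sets (PiM I (\<lambda>i. density (N i) (f i)))"
      by (simp cong: sets_PiM_cong)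
    fix A assume "\<And>i. i \<in> I \<Longrightarrow> A i \<in> sets (density (N i) (f i))"
    then have A: "\<And>i. i \<in> I \<Longrightarrow> A i \<in> sets (N i)" by simp
    then have "PiE I A \<in> sets (PiM I N)" using I by (intro sets_PiM_I_finite) auto
    then have "emeasure (density (PiM I N) (\<lambda>x. \<Prod>i\<in>I. f i (x i))) (PiE I A)
        = (\<integral>\<^sup>+x. (\<Prod>i\<in>I. f i (x i)) * indicator (PiE I A) x \<partial>PiM I N)"
      using F by (rule emeasure_density[rotated])
    also have "\<dots> = (\<integral>\<^sup>+x. (\<Prod>i\<in>I. f i (x i) * indicator (A i) (x i)) \<partial>PiM I N)"
    proof (rule nn_integral_cong)
      fix x assume "x \<in> space (PiM I N)"
      then have "x \<in> extensional I" by (auto simp: space_PiM PiE_def)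
      then have "indicator (PiE I A) x = (\<Prod>i\<in>I. indicator (A i) (x i) :: ennreal)"
        using I by (auto simp: PiE_def Pi_def indicator_def)
      then show "(\<Prod>i\<in>I. f i (x i)) * indicator (PiE I A) x
          = (\<Prod>i\<in>I. f i (x i) * indicator (A i) (x i))"
        by (simp add: prod.distrib)
    qed
    also have "\<dots> = (\<Prod>i\<in>I. \<integral>\<^sup>+x. f i x * indicator (A i) x \<partial>N i)"
      using A by (intro N.product_nn_integral_prod I) auto
    also have "\<dots> = (\<Prod>i\<in>I. emeasure (density (N i) (f i)) (A i))"
      using A by (intro prod.cong refl) (simp add: emeasure_density)
    finally show "emeasure (density (PiM I N) (\<lambda>x. \<Prod>i\<in>I. f i (x i))) (PiE I A)
        = (\<Prod>i\<in>I. emeasure (density (N i) (f i)) (A i))" .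
  qed
qed

context prob_space
begin

lemma distributed_indep_normal:
  assumes I: "finite I" "I \<noteq> {}"
    and indep: "indep_vars (\<lambda>_. borel) Y I"
    and Y: "\<And>i. i \<in> I \<Longrightarrow> distributed M lborel (Y i) (normal_density (\<mu> i) 1)"
  shows "distr M (PiM I (\<lambda>_. lborel)) (\<lambda>\<omega>. \<lambda>i\<in>I. Y i \<omega>) =
    density (PiM I (\<lambda>_. lborel)) (\<lambda>a. ennreal (\<Prod>i\<in>I. normal_density (\<mu> i) 1 (a i)))"
proof -
  have meas: "Y i \<in> borel_measurable M" if "i \<in> I" for i
    using distributed_measurable[OF Y[OF that]] by simp
  have "distr M (PiM I (\<lambda>_. lborel)) (\<lambda>\<omega>. \<lambda>i\<in>I. Y i \<omega>)
      = distr M (PiM I (\<lambda>_. borel)) (\<lambda>\<omega>. \<lambda>i\<in>I. Y i \<omega>)"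
    by (intro distr_cong sets_PiM_cong) auto
  also have "\<dots> = PiM I (\<lambda>i. distr M borel (Y i))"
    using indep_vars_iff_distr_eq_PiM'[OF I(2), of Y "\<lambda>_. borel"] indep meas by simp
  also have "\<dots> = PiM I (\<lambda>i. density lborel (normal_density (\<mu> i) 1))"
  proof (rule PiM_cong)
    fix i assume "i \<in> I"
    from distributed_distr_eq_density[OF Y[OF this]]
    show "distr M borel (Y i) = density lborel (normal_density (\<mu> i) 1)"
      by (simp cong: distr_cong)
  qed simp
  also have "\<dots> = density (PiM I (\<lambda>_. lborel)) (\<lambda>a. \<Prod>i\<in>I. ennreal (normal_density (\<mu> i) 1 (a i)))"
    using I(1)
    by (intro PiM_density)
       (auto intro!: lborel.sigma_finite_measure_axioms prob_space_imp_sigma_finite prob_space_normal_density)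
  also have "\<dots> = density (PiM I (\<lambda>_. lborel)) (\<lambda>a. ennreal (\<Prod>i\<in>I. normal_density (\<mu> i) 1 (a i)))"
    by (simp add: prod_ennreal)
  finally show ?thesis .
qed

end

lemma prod_normal_density:
  assumes "finite I"
  shows "(\<Prod>i\<in>I. normal_density (\<mu> i) 1 (a i))
    = (1 / sqrt (2 * pi)) ^ card I * exp (- (1/2) * (\<Sum>i\<in>I. (a i - \<mu> i)\<^sup>2))"
proof -
  have "(\<Prod>i\<in>I. normal_density (\<mu> i) 1 (a i))
      = (\<Prod>i\<in>I. 1 / sqrt (2 * pi) * exp (- (1/2) * (a i - \<mu> i)\<^sup>2))"
    by (simp add: normal_density_def)
  also have "\<dots> = (1 / sqrt (2 * pi)) ^ card I * (\<Prod>i\<in>I. exp (- (1/2) * (a i - \<mu> i)\<^sup>2))"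
    unfolding prod.distrib by simp
  also have "(\<Prod>i\<in>I. exp (- (1/2) * (a i - \<mu> i)\<^sup>2)) = exp (\<Sum>i\<in>I. - (1/2) * (a i - \<mu> i)\<^sup>2)"
    using assms by (simp add: exp_sum)
  finally show ?thesis unfolding sum_distrib_left .
qed

section \<open>The random piecewise linear function\<close>

context PL_orthonormal_basis
begin

text \<open>
  Vectors are taken here as functions on all of \<open>nat\<close>, where the product sigma-algebra is the Borel
  sigma-algebra of the product topology; \<open>comb\<close> ignores the coordinates outside \<open>{1..2^n}\<close>.
\<close>

lemma open_comb_vimage:
  assumes U: "Metric_space.mopen (PL n) (H1_dist \<epsilon>) U"
  shows "open (comb -` U)"
proof (subst open_subopen, intro ballI)
  interpret PL: Metric_space "PL n" "H1_dist \<epsilon>" by (rule Metric_space_PL)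
  fix a assume "a \<in> comb -` U"
  then obtain r where r: "r > 0" "PL.mball (comb a) r \<subseteq> U"
    using U by (auto simp: PL.mopen_def)
  define B where "B = {b. L2_set (\<lambda>j. a j - b j) {1..2^n} < r}"
  have "open B"
    unfolding B_def L2_set_def
    by (intro open_Collect_less continuous_intros continuous_on_product_coordinates)
  moreover have "a \<in> B" using r by (simp add: B_def L2_set_def)
  moreover have "B \<subseteq> comb -` U"
    using r(2) by (auto simp: B_def H1_dist_comb comb_PL subset_iff)
  ultimately show "\<exists>T. open T \<and> a \<in> T \<and> T \<subseteq> comb -` U" by blast
qed

lemma comb_measurable: "comb \<in> PiM UNIV (\<lambda>_. borel) \<rightarrow>\<^sub>M PL_borel \<epsilon> n"
proof (rule measurable_sigma_sets[OF sets_PL_borel])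
  show "{U. Metric_space.mopen (PL n) (H1_dist \<epsilon>) U} \<subseteq> Pow (PL n)"
    by (auto simp: Metric_space.mopen_def[OF Metric_space_PL])
  show "comb \<in> space (PiM UNIV (\<lambda>_. borel)) \<rightarrow> PL n" by (simp add: comb_PL)
  fix U assume "U \<in> {U. Metric_space.mopen (PL n) (H1_dist \<epsilon>) U}"
  then have "comb -` U \<in> sets (borel :: (nat \<Rightarrow> real) measure)"
    by (intro borel_open open_comb_vimage) simp
  then show "comb -` U \<inter> space (PiM UNIV (\<lambda>_. borel)) \<in> sets (PiM UNIV (\<lambda>_. borel))"
    by (simp add: sets_PiM_equal_borel space_PiM)
qed

lemma random_comb_measurable:
  assumes "\<And>j. j \<in> {1..2^n} \<Longrightarrow> Y j \<in> borel_measurable M"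
  shows "(\<lambda>\<omega>. comb (\<lambda>j. Y j \<omega>)) \<in> M \<rightarrow>\<^sub>M PL_borel \<epsilon> n"
proof -
  have "(\<lambda>\<omega> j. if j \<in> {1..2^n} then Y j \<omega> else 0) \<in> M \<rightarrow>\<^sub>M PiM UNIV (\<lambda>_. borel)"
  proof (rule measurable_PiM_single')
    fix j :: nat
    show "(\<lambda>\<omega>. if j \<in> {1..2^n} then Y j \<omega> else 0) \<in> borel_measurable M"
      using assms by (cases "j \<in> {1..2^n}") (simp_all only: if_True if_False borel_measurable_const)
  qed simp
  from measurable_compose[OF this comb_measurable]
  have "(\<lambda>\<omega>. comb (\<lambda>j. if j \<in> {1..2^n} then Y j \<omega> else 0)) \<in> M \<rightarrow>\<^sub>M PL_borel \<epsilon> n" .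
  also have "(\<lambda>\<omega>. comb (\<lambda>j. if j \<in> {1..2^n} then Y j \<omega> else 0)) = (\<lambda>\<omega>. comb (\<lambda>j. Y j \<omega>))"
    by (intro ext fun_cong[OF comb_cong]) simp
  finally show ?thesis .
qed

lemma J_measurable: "\<J> g n \<in> PL_borel \<epsilon> n \<rightarrow>\<^sub>M lebesgue_N (2^n)"
  unfolding lebesgue_N_def
proof (rule measurable_PiM_single')
  show "(\<lambda>f. \<J> g n f j) \<in> PL_borel \<epsilon> n \<rightarrow>\<^sub>M lborel" if "j \<in> {1..2^n}" for j
    using coord_measurable[OF that] by simp
  have "\<J> g n f \<in> extensional {1..2^n}" if "f \<in> PL n" for f
    using PL_cases[OF that] by (metis coord_comb restrict_extensional)
  then show "\<J> g n \<in> space (PL_borel \<epsilon> n) \<rightarrow> {1..2^n} \<rightarrow>\<^sub>E space lborel"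
    by (auto simp: PiE_def)
qed

lemma const_PL: "(\<lambda>x. c) \<in> PL n"
proof -
  have "\<exists>a b. \<forall>x\<in>K. c = a * x + b" for K :: "real set"
    by (rule exI[of _ 0], rule exI[of _ c]) simp
  then show ?thesis by (simp add: PL_def C_circle_def periodic1_def)
qed

text \<open>
  A constant has weak derivative 0, so the gradient term of \<open>v\<close> is that of \<open>v - 1\<close>, and the energy is
  the squared norm of \<open>v - 1\<close>, which Parseval's identity expresses in coordinates.
\<close>

lemma shifted_energy:
  assumes v: "v = comb a" and one: "(\<lambda>x. 1) = comb b"
  shows "\<epsilon> * (L2_norm (wderiv v))\<^sup>2 + 1 / (4 * \<epsilon>) * (L2_norm (\<lambda>x. v x - 1))\<^sup>2
    = (\<Sum>j=1..2^n. (a j - b j)\<^sup>2)"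
proof -
  have vH1: "v \<in> H1_circle" unfolding v by (rule comb_H1)
  have "(\<lambda>x. 1) \<in> C_circle" by (simp add: C_circle_def periodic1_def)
  from weak_deriv_lin[OF _ this H1_circle_weak_deriv[OF vH1] weak_deriv_const, of 1 "-1"] vH1
  have w: "weak_deriv (\<lambda>x. v x - 1) (wderiv v)" by (simp add: H1_circle_def)
  have "(\<lambda>x. v x - 1) = comb (\<lambda>j. a j - b j)"
    unfolding v comb_diff[symmetric] one[symmetric] ..
  then have "H1_inner \<epsilon> (\<lambda>x. v x - 1) (\<lambda>x. v x - 1) = (\<Sum>j=1..2^n. (a j - b j)\<^sup>2)"
    by (simp add: H1_inner_comb power2_eq_square)
  then show ?thesis
    unfolding H1_inner_eq[OF w w] L2_norm_def by (simp add: L2_inner_nonneg)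
qed

end

section \<open>The density of the coordinates\<close>

theorem theorem2:
  fixes \<epsilon> :: real
    and g :: "nat \<Rightarrow> real \<Rightarrow> real"
    and M :: "'w measure"
    and X :: "nat \<Rightarrow> nat \<Rightarrow> 'w \<Rightarrow> real"
    and n :: nat
  assumes "\<epsilon> > 0"
    and "H1_orthonormal_basis \<epsilon> g"
    and "\<And>m. range (lin_comb g (2^m)) = PL m"
    and "prob_space M"
    and "prob_space.indep_vars M (\<lambda>_. borel) (X (2^n)) {1..2^n}"
    and "\<And>j. j \<in> {1..2^n} \<Longrightarrow> distributed M lborel (X (2^n) j) std_normal_density"
  shows "\<exists>p. (\<forall>a. 0 \<le> p a) \<and>
     distributed (\<nu> \<epsilon> g M X n) (lebesgue_N (2^n)) (\<J> g n) (\<lambda>a. ennreal (p a)) \<and>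
     (\<exists>c>0. \<forall>v\<in>PL n. p (\<J> g n v) =
        c * exp (- (1/2) * (\<epsilon> * (L2_norm (wderiv v))\<^sup>2
                          + 1 / (4 * \<epsilon>) * (L2_norm (\<lambda>x. v x - 1))\<^sup>2)))"
proof -
  interpret PL_orthonormal_basis \<epsilon> g n
    by unfold_locales (use assms(1-3) in \<open>auto simp: H1_orthonormal_basis_def\<close>)
  interpret prob_space M by fact
  let ?I = "{1..2^n} :: nat set"
  obtain b where b: "(\<lambda>x. 1) = comb b" using const_PL by (rule PL_cases)
  define Y where "Y = (\<lambda>j \<omega>. b j + 1 * X (2^n) j \<omega>)"
  define p where "p = (\<lambda>a. \<Prod>j\<in>?I. normal_density (b j) 1 (a j))"
  have Y: "distributed M lborel (Y j) (normal_density (b j) 1)" if "j \<in> ?I" for j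
    using normal_density_affine[OF assms(6)[OF that], of 1 "b j"] by (simp add: Y_def)
  have Y_meas: "Y j \<in> borel_measurable M" if "j \<in> ?I" for j
    using distributed_measurable[OF Y[OF that]] by simp
  have Y_indep: "indep_vars (\<lambda>_. borel) Y ?I"
    unfolding Y_def by (rule indep_vars_compose2[OF assms(5)]) simp
  have V: "V g X n = (\<lambda>\<omega>. comb (\<lambda>j. Y j \<omega>))"
  proof
    fix \<omega>
    have "V g X n \<omega> = (\<lambda>x. comb b x + comb (\<lambda>j. X (2^n) j \<omega>) x)"
      unfolding b[symmetric] by (simp add: V_def lin_comb_def add.commute)
    then show "V g X n \<omega> = comb (\<lambda>j. Y j \<omega>)" unfolding comb_add Y_def by simp
  qed
  have V_meas: "V g X n \<in> M \<rightarrow>\<^sub>M PL_borel \<epsilon> n"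
    unfolding V using Y_meas by (rule random_comb_measurable)
  have "distr (\<nu> \<epsilon> g M X n) (lebesgue_N (2^n)) (\<J> g n)
      = distr M (lebesgue_N (2^n)) (\<lambda>\<omega>. \<lambda>j\<in>?I. Y j \<omega>)"
    unfolding \<nu>_def distr_distr[OF J_measurable V_meas] by (simp add: V coord_comb comp_def)
  also have "\<dots> = density (lebesgue_N (2^n)) (\<lambda>a. ennreal (p a))"
    unfolding lebesgue_N_def p_def using Y_indep Y by (intro distributed_indep_normal) auto
  finally have "distr (\<nu> \<epsilon> g M X n) (lebesgue_N (2^n)) (\<J> g n)
      = density (lebesgue_N (2^n)) (\<lambda>a. ennreal (p a))" .
  moreover have "\<J> g n \<in> \<nu> \<epsilon> g M X n \<rightarrow>\<^sub>M lebesgue_N (2^n)"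
    using J_measurable by (simp add: \<nu>_def)
  moreover have "(\<lambda>a. ennreal (p a)) \<in> borel_measurable (lebesgue_N (2^n))"
    unfolding p_def lebesgue_N_def by measurable
  ultimately have "distributed (\<nu> \<epsilon> g M X n) (lebesgue_N (2^n)) (\<J> g n) (\<lambda>a. ennreal (p a))"
    by (simp add: distributed_def)
  moreover have "0 \<le> p a" for a unfolding p_def by (intro prod_nonneg) simp
  moreover have "p (\<J> g n v) = (1 / sqrt (2 * pi)) ^ 2 ^ n *
      exp (- (1/2) * (\<epsilon> * (L2_norm (wderiv v))\<^sup>2 + 1 / (4 * \<epsilon>) * (L2_norm (\<lambda>x. v x - 1))\<^sup>2))"
    if v: "v \<in> PL n" for v
  proof -
    obtain a where a: "v = comb a" using v by (rule PL_cases)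
    have "p (\<J> g n v) = (\<Prod>j\<in>?I. normal_density (b j) 1 (a j))"
      unfolding a coord_comb p_def by (intro prod.cong) auto
    then show ?thesis unfolding shifted_energy[OF a b] by (simp add: prod_normal_density)
  qed
  moreover have "(0::real) < (1 / sqrt (2 * pi)) ^ 2 ^ n" by simp
  ultimately show ?thesis by blast
qed

end
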